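(* Let $F$ be the unit $n$-dimensional cube ($n$ finite), described as the collection of points $F=\{F_{i_1i_2\ldots i_k\ldots} \mid i_p=1,2,\ldots,4^n,\ p=1,2,\ldots\}$ obtained by repeatedly partitioning each sub-cube into $4^n$ equal sub-cubes, and let the generator $\varphi:F\to F$ be defined by $\varphi(F_{i_1i_2\ldots i_k\ldots})=F_{i_2i_3\ldots i_k\ldots}$. Then the map $\varphi$ possesses the three ingredients of Devaney chaos, namely density of periodic points in $F$, transitivity and sensitivity.
   Context: Partition. The unit cube $F\subset\mathbb{R}^n$ (the Cartesian product of $n$ unit intervals) is divided into $4^n$ equal parts ($n$-dimensional sub-cubes) denoted $F_{i_1}$, $i_1=1,2,\ldots,4^n$. Each part $F_{i_1}$ is again divided into $4^n$ equal parts denoted $F_{i_1i_2}$, $i_2=1,2,\ldots,4^n$, and so on: at the $k$-th step each part $F_{i_1\ldots i_{k-1}}$ is divided into $4^n$ equal sub-cubes denoted $F_{i_1i_2\ldots i_k}$, $i_p=1,2,\ldots,4^n$, $p=1,\ldots,k$. For $n=1$ the first step is $F=[0,1]$ with $F_1=[0,\frac14]$, $F_2=(\frac14,\frac12]$, $F_3=(\frac12,\frac34]$, $F_4=(\frac34,1]$. The diameter $\sqrt{n}/4^k$ of $F_{i_1\ldots i_k}$ tends to zero as $k\to\infty$, and an infinite iteration of the procedure produces the points of which the cube consists; these points are represented by $F_{i_1i_2\ldots i_k\ldots}$, $i_p=1,2,\ldots,4^n$, $p=1,2,\ldots$, and the cube $F$ is represented as the collection of all of them. Generator. $\varphi:F\to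 F$ is the map on the points of the cube given by $\varphi(F_{i_1i_2\ldots i_k\ldots})=F_{i_2i_3\ldots i_k\ldots}$, such that for a fixed finite sequence $i_1i_2\ldots i_k$ one has $\varphi(F_{i_1i_2\ldots i_k})=F_{i_2i_3\ldots i_k}$, and $\varphi(F_{i_1})=F$. Definitions. $d$ is the usual Euclidean metric; density is with respect to $d$. A point $F_{i_1i_2i_3\ldots}\in F$ is periodic with period $p$ if its index consists of endless repetitions of a block of $p$ terms. Transitivity: there is an element $l\in F$ such that for any subset $F_{i_1i_2\ldots i_q}$ there exists a sufficiently large integer $p$ with $\varphi^p(l)\in F_{i_1i_2\ldots i_q}$. Sensitivity: there is $\varepsilon_0>0$ such that for every $x\in F$ and every $\varepsilon>0$ there are $y\in F$ with $d(x,y)<\varepsilon$ and a positive integer $p$ with $d(\varphi^p(x),\varphi^p(y))\ge\varepsilon_0$. *)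

theory Defs
  imports "HOL-Analysis.Analysis"
begin

definition unit_cube :: "(real ^ 'n) set" where
  "unit_cube = {x. \<forall>j. 0 \<le> x $ j \<and> x $ j \<le> 1}"

text \<open>
  A numbering of the equal parts of a cube: part number \<open>i\<close> is the one whose position along axis
  \<open>j\<close> is \<open>e i j\<close>, counted from 0 to 3. The order in which the parts are numbered is arbitrary, but
  it is the same for every cube that is divided.
\<close>
definition part_numbering :: "(nat \<Rightarrow> 'n::finite \<Rightarrow> nat) \<Rightarrow> bool" where
  "part_numbering e \<longleftrightarrow> bij_betw e {1..4 ^ CARD('n)} {c. \<forall>j. c j < 4}"

definition corner :: "(nat \<Rightarrow> 'n::finite \<Rightarrow> nat) \<Rightarrow> nat list \<Rightarrow> real ^ 'n" where
  "corner e w = (\<chi> j. \<Sum>m<length w. real (e (w ! m) j) / 4 ^ Suc m)"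

text \<open>
  The half-open convention \<open>[0,1/4]\<close>, \<open>(1/4,1/2]\<close>, \<open>(1/2,3/4]\<close>, \<open>(3/4,1]\<close> is applied along each
  axis, so the parts of any given level are pairwise disjoint and cover the cube. The lower face of a
  part belongs to it only if it lies on the boundary of the unit cube.
\<close>
definition subcube :: "(nat \<Rightarrow> 'n::finite \<Rightarrow> nat) \<Rightarrow> nat list \<Rightarrow> (real ^ 'n) set" where
  "subcube e w = {x. \<forall>j.
     (corner e w $ j < x $ j \<or> (corner e w $ j = 0 \<and> x $ j = 0)) \<and>
     x $ j \<le> corner e w $ j + 1 / 4 ^ length w}"

text \<open>
  Infinite indices are functions on \<open>nat\<close>, starting at 0: \<open>s m\<close> is the index with subscript
  \<open>m + 1\<close>.
\<close>
definition prefix_of :: "(nat \<Rightarrow> nat) \<Rightarrow> nat \<Rightarrow> nat list" where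
  "prefix_of s k = map s [0..<k]"

definition shift :: "(nat \<Rightarrow> nat) \<Rightarrow> nat \<Rightarrow> nat" where
  "shift s = (\<lambda>m. s (Suc m))"

definition symbol_sequences :: "nat \<Rightarrow> (nat \<Rightarrow> nat) set" where
  "symbol_sequences N = {s. \<forall>m. s m \<in> {1..N}}"

text \<open>
  The point with a given infinite index. Closures are needed: for \<open>n = 1\<close> in the natural order, the
  half-open parts with indices 2, 21, 211, and so on have empty intersection.
\<close>
definition point_of :: "(nat \<Rightarrow> 'n::finite \<Rightarrow> nat) \<Rightarrow> (nat \<Rightarrow> nat) \<Rightarrow> real ^ 'n" where
  "point_of e s = (THE x. \<forall>k. x \<in> closure (subcube e (prefix_of s k)))"

definition index_of :: "(nat \<Rightarrow> 'n::finite \<Rightarrow> nat) \<Rightarrow> real ^ 'n \<Rightarrow> nat \<Rightarrow> nat" where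
  "index_of e x =
     (THE s. s \<in> symbol_sequences (4 ^ CARD('n)) \<and> (\<forall>k. x \<in> subcube e (prefix_of s k)))"

text \<open>
  Boundary points of parts are limits of several infinite indices, whose shifts denote different
  points in general. As a map on the points of the cube, the generator therefore uses the index that
  the half-open partition assigns to the point.
\<close>
definition generator :: "(nat \<Rightarrow> 'n::finite \<Rightarrow> nat) \<Rightarrow> real ^ 'n \<Rightarrow> real ^ 'n" where
  "generator e x = point_of e (shift (index_of e x))"

text \<open>
  The ingredients of chaos, for a collection \<open>X\<close> of points: \<open>pos x\<close> is the position of the point
  \<open>x\<close> in space, so distances are \<open>dist (pos x) (pos y)\<close>, \<open>idx x\<close> is its infinite index, and
  \<open>P w\<close> is the part with the finite index \<open>w\<close>.
\<close>
definition periodic_point :: "('a \<Rightarrow> nat \<Rightarrow> nat) \<Rightarrow> nat \<Rightarrow> 'a \<Rightarrow> bool" where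
  "periodic_point idx p x \<longleftrightarrow> 0 < p \<and> (\<forall>m. idx x (m + p) = idx x m)"

definition periodic_points_dense ::
    "'a set \<Rightarrow> ('a \<Rightarrow> 'b::metric_space) \<Rightarrow> ('a \<Rightarrow> nat \<Rightarrow> nat) \<Rightarrow> bool" where
  "periodic_points_dense X pos idx \<longleftrightarrow>
     pos ` X \<subseteq> closure (pos ` {x \<in> X. \<exists>p. periodic_point idx p x})"

definition transitive_map ::
    "nat \<Rightarrow> 'a set \<Rightarrow> (nat list \<Rightarrow> 'a set) \<Rightarrow> ('a \<Rightarrow> 'a) \<Rightarrow> bool" where
  "transitive_map N X P f \<longleftrightarrow>
     (\<exists>l\<in>X. \<forall>w\<in>lists {1..N}. \<exists>p>0. (f ^^ p) l \<in> P w)"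

definition sensitive_map :: "'a set \<Rightarrow> ('a \<Rightarrow> 'b::metric_space) \<Rightarrow> ('a \<Rightarrow> 'a) \<Rightarrow> bool" where
  "sensitive_map X pos f \<longleftrightarrow>
     (\<exists>\<epsilon>\<^sub>0>0. \<forall>x\<in>X. \<forall>\<epsilon>>0. \<exists>y\<in>X. dist (pos x) (pos y) < \<epsilon> \<and>
        (\<exists>p>0. dist (pos ((f ^^ p) x)) (pos ((f ^^ p) y)) \<ge> \<epsilon>\<^sub>0))"

definition devaney_chaotic ::
    "nat \<Rightarrow> 'a set \<Rightarrow> ('a \<Rightarrow> 'b::metric_space) \<Rightarrow> ('a \<Rightarrow> nat \<Rightarrow> nat) \<Rightarrow>
     (nat list \<Rightarrow> 'a set) \<Rightarrow> ('a \<Rightarrow> 'a) \<Rightarrow> bool" where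
  "devaney_chaotic N X pos idx P f \<longleftrightarrow>
     periodic_points_dense X pos idx \<and> transitive_map N X P f \<and> sensitive_map X pos f"

text \<open>
  The part with finite index \<open>w\<close> when the cube is read as the collection of all infinite indices.
\<close>
definition cylinder :: "nat \<Rightarrow> nat list \<Rightarrow> (nat \<Rightarrow> nat) set" where
  "cylinder N w = {s \<in> symbol_sequences N. prefix_of s (length w) = w}"

end

(*
  A sequence whose digits along every axis are infinitely often nonzero ("rich") is the index that
  the half-open partition assigns to its point, so on such sequences the generator is the shift.
  All witnesses are taken rich: repetitions of a block that ends with the symbol of the all-3 digit,
  a sequence that contains every finite word, and sequences whose tail is constantly the all-3 or the
  all-1 symbol. The last two tails represent points at distance at least 2/3, so one of them is far
  from any given point; this gives sensitivity.
*)
theory Submission imports Defs begin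

section \<open>Shifts, prefixes and corners\<close>

lemma funpow_shift: "(shift ^^ p) s = (\<lambda>m. s (m + p))"
  by (induction p) (auto simp: shift_def)

lemma length_prefix_of [simp]: "length (prefix_of s k) = k"
  by (simp add: prefix_of_def)

lemma prefix_of_Suc: "prefix_of s (Suc k) = prefix_of s k @ [s k]"
  by (simp add: prefix_of_def)

lemma prefix_of_Suc_shift: "prefix_of s (Suc k) = s 0 # prefix_of (shift s) k"
  by (rule nth_equalityI) (auto simp: prefix_of_def shift_def nth_Cons simp del: upt_Suc split: nat.split)

lemma shift_in_symbol_sequences: "s \<in> symbol_sequences N \<Longrightarrow> shift s \<in> symbol_sequences N"
  by (simp add: symbol_sequences_def shift_def)

lemma corner_append:
  "corner e (w @ [i]) $ j = corner e w $ j + real (e i j) / 4 ^ Suc (length w)"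
  by (simp add: corner_def nth_append)

lemma corner_Cons: "corner e (i # w) $ j = (real (e i j) + corner e w $ j) / 4"
  unfolding corner_def
  by (simp add: sum.lessThan_Suc_shift sum_divide_distrib add_divide_distrib mult.commute del: sum.lessThan_Suc)

lemma corner_nonneg: "0 \<le> corner e w $ j"
  by (simp add: corner_def sum_nonneg)

lemma corner_prefix_of:
  "corner e (prefix_of s k) $ j = (\<Sum>m<k. real (e (s m) j) / 4 ^ Suc m)"
  by (simp add: corner_def prefix_of_def)

lemma subcube_Nil: "subcube e [] = unit_cube"
  by (auto simp: subcube_def unit_cube_def corner_def order.order_iff_strict)

text \<open>The affine map that enlarges part \<open>i\<close> to the whole cube respects the
  half-open faces. This is what makes the half-open index of an image under the generator equal to
  the shifted index.\<close>

lemma subcube_ConsD: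
  assumes "x \<in> subcube e (i # w)"
  shows "(\<chi> j. 4 * x $ j - real (e i j)) \<in> subcube e w"
proof -
  have "corner e w $ j < 4 * x $ j - real (e i j) \<or>
      corner e w $ j = 0 \<and> 4 * x $ j - real (e i j) = 0" for j
  proof (cases "corner e (i # w) $ j < x $ j")
    case True
    then show ?thesis by (simp add: corner_Cons)
  next
    case False
    then have "corner e (i # w) $ j = 0" "x $ j = 0"
      using assms by (auto simp: subcube_def)
    \<comment> \<open>Both summands in \<open>corner_Cons\<close> are nonnegative, so a zero corner
      forces the digit and the inner corner to vanish: the exceptional lower face is mapped to the
      exceptional lower face.\<close>
    then show ?thesis
      using corner_nonneg[of e w j] by (simp add: corner_Cons)
  qed
  moreover have "4 * x $ j - real (e i j) \<le> corner e w $ j + 1 / 4 ^ length w" for j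
  proof -
    have "x $ j \<le> corner e (i # w) $ j + 1 / 4 ^ length (i # w)"
      using assms by (auto simp: subcube_def)
    then show ?thesis by (simp add: corner_Cons field_simps)
  qed
  ultimately show ?thesis by (auto simp: subcube_def)
qed

section \<open>Closures of parts and the division of one axis\<close>

lemma closure_subcube:
  "closure (subcube e w) = cbox (corner e w) (corner e w + (\<chi> j. 1 / 4 ^ length w))"
    (is "_ = cbox ?a ?b")
proof
  have "subcube e w \<subseteq> cbox ?a ?b"
    by (auto simp: subcube_def mem_box_cart less_imp_le) (metis less_imp_le order_refl)
  then show "closure (subcube e w) \<subseteq> cbox ?a ?b"
    by (simp add: closure_minimal closed_cbox)
  \<comment> \<open>The part lies between the open and the closed box; the open box is nonempty, so
    its closure is already the closed one.\<close>
  have "box ?a ?b \<subseteq> subcube e w"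
    by (auto simp: subcube_def mem_box_cart less_imp_le)
  moreover have "box ?a ?b \<noteq> {}"
    by (simp add: interval_ne_empty_cart)
  ultimately show "cbox ?a ?b \<subseteq> closure (subcube e w)"
    by (metis closure_box closure_mono)
qed

text \<open>The half-open convention along one axis, for a part with lower end \<open>c\<close> and parts of length \<open>h\<close>.\<close>

lemma quarter_exists:
  fixes c x h :: real
  assumes "0 \<le> c" "0 < h" "c < x \<or> c = 0 \<and> x = 0" "x \<le> c + 4 * h"
  shows "\<exists>d<4. (c + real d * h < x \<or> c + real d * h = 0 \<and> x = 0) \<and> x \<le> c + real d * h + h"
proof -
  consider "x \<le> c + h" | "c + h < x" "x \<le> c + 2 * h" | "c + 2 * h < x" "x \<le> c + 3 * h"
    | "c + 3 * h < x" by linarith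
  then show ?thesis
  proof cases
    case 1 then show ?thesis using assms by (intro exI[of _ 0]) auto
  next
    case 2 then show ?thesis using assms by (intro exI[of _ 1]) auto
  next
    case 3 then show ?thesis using assms by (intro exI[of _ 2]) auto
  next
    case 4 then show ?thesis using assms by (intro exI[of _ 3]) auto
  qed
qed

lemma quarter_unique:
  fixes c x h :: real and d d' :: nat
  assumes "0 \<le> c" "0 < h"
    and "c + real d * h < x \<or> c + real d * h = 0 \<and> x = 0" "x \<le> c + real d * h + h"
    and "c + real d' * h < x \<or> c + real d' * h = 0 \<and> x = 0" "x \<le> c + real d' * h + h"
  shows "d = d'"
proof -
  \<comment> \<open>By symmetry one inequality is enough. If \<open>b < a\<close>, the lower end of
    quarter \<open>a\<close> is positive and at least the upper end of quarter \<open>b\<close>,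
    which rules out both alternatives for \<open>x\<close>.\<close>
  have "a \<le> b"
    if a: "c + real a * h < x \<or> c + real a * h = 0 \<and> x = 0" and b: "x \<le> c + real b * h + h"
    for a b :: nat
  proof (rule ccontr)
    assume "\<not> a \<le> b"
    then have "real b + 1 \<le> real a" by linarith
    then have "(real b + 1) * h \<le> real a * h" using \<open>0 < h\<close> by (simp add: mult_right_mono)
    moreover have "0 < (real b + 1) * h" using \<open>0 < h\<close> by simp
    ultimately show False using a b \<open>0 \<le> c\<close> by (auto simp: algebra_simps)
  qed
  then show ?thesis using assms by (simp add: order.antisym)
qed

text \<open>The new side length stays a separate factor so that each axis matches the quarter lemmas
  with that length as \<open>h\<close>.\<close>

lemma subcube_append_iff:
  "x \<in> subcube e (w @ [i]) \<longleftrightarrow>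
    (\<forall>j. (corner e w $ j + real (e i j) * (1 / 4 ^ Suc (length w)) < x $ j \<or>
          corner e w $ j + real (e i j) * (1 / 4 ^ Suc (length w)) = 0 \<and> x $ j = 0) \<and>
         x $ j \<le> corner e w $ j + real (e i j) * (1 / 4 ^ Suc (length w)) + 1 / 4 ^ Suc (length w))"
  by (simp add: subcube_def corner_append)

section \<open>Base-4 expansions and a sequence containing all words\<close>

text \<open>An explicit series for the point with index \<open>s\<close>; on
  \<open>symbol_sequences N\<close> it is later shown to agree with \<open>point_of\<close>.\<close>

definition expansion :: "(nat \<Rightarrow> 'n::finite \<Rightarrow> nat) \<Rightarrow> (nat \<Rightarrow> nat) \<Rightarrow> real ^ 'n" where
  "expansion e s = (\<chi> j. \<Sum>m. real (e (s m) j) / 4 ^ Suc m)"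

text \<open>Rules out expansions that end in zeros along some axis. Such a point lies on a lower
  face, which the half-open convention gives to the neighbouring part unless the coordinate is
  0.\<close>

definition rich :: "(nat \<Rightarrow> 'n::finite \<Rightarrow> nat) \<Rightarrow> (nat \<Rightarrow> nat) \<Rightarrow> bool" where
  "rich e s \<longleftrightarrow> (\<forall>j k. \<exists>m\<ge>k. 0 < e (s m) j)"

lemma universal_sequence:
  assumes "1 \<le> N"
  shows "\<exists>s\<in>symbol_sequences N. \<forall>w\<in>lists {1..N}. \<exists>p. \<forall>i<length w. s (p + i) = w ! i"
proof -
  have "lists {1..N} \<noteq> {}" by auto
  \<comment> \<open>By the negation of \<open>uncountable_def\<close>, a nonempty countable set is
    the range of a function on the naturals.\<close>
  then obtain W :: "nat \<Rightarrow> nat list" where W: "lists {1..N} = range W"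
    using uncountable_def[of "lists {1..N}"] countable_lists[of "{1..N}"] by auto
  \<comment> \<open>The extra letter 1 makes every stage strictly longer, even when
    \<open>W n\<close> is empty; hence position \<open>m\<close> is already filled at stage
    \<open>Suc m\<close>.\<close>
  define L where "L n = concat (map (\<lambda>i. W i @ [1]) [0..<n])" for n
  have L_Suc: "L (Suc n) = L n @ W n @ [1]" for n by (simp add: L_def)
  have len: "n \<le> length (L n)" for n
    by (induction n) (auto simp: L_Suc)
  have L_set: "set (L n) \<subseteq> {1..N}" for n
  proof (induction n)
    case (Suc n)
    have "W n \<in> lists {1..N}" using W by simp
    then show ?case using Suc \<open>1 \<le> N\<close> by (auto simp: L_Suc)
  qed (simp add: L_def)
  have L_nth_add: "L (n + k) ! m = L n ! m" if "m < length (L n)" for n k m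
  proof (induction k)
    case (Suc k)
    have "length (L n) \<le> length (L (n + k))" by (induction k) (auto simp: L_Suc)
    then show ?case using Suc that by (simp add: L_Suc nth_append)
  qed simp
  \<comment> \<open>Of two stages one is an initial segment of the other, so every stage that
    reaches position \<open>m\<close> has the same letter there.\<close>
  have L_nth: "L n ! m = L (Suc m) ! m" if "m < length (L n)" for n m
  proof (cases "n \<le> Suc m")
    case True
    then show ?thesis using L_nth_add[OF that, of "Suc m - n"] by simp
  next
    case False
    moreover have "m < length (L (Suc m))" using len[of "Suc m"] by simp
    ultimately show ?thesis using L_nth_add[of m "Suc m" "n - Suc m"] by simp
  qed
  define s where "s m = L (Suc m) ! m" for m
  have "s m \<in> {1..N}" for m
    using L_set[of "Suc m"] len[of "Suc m"] nth_mem[of m "L (Suc m)"]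
    unfolding s_def by (meson Suc_le_eq subsetD)
  then have "s \<in> symbol_sequences N" by (simp add: symbol_sequences_def)
  moreover have "\<exists>p. \<forall>i<length w. s (p + i) = w ! i" if w: "w \<in> lists {1..N}" for w
  proof -
    obtain n where n: "w = W n" using w W by blast
    have "s (length (L n) + i) = w ! i" if "i < length w" for i
    proof -
      have "s (length (L n) + i) = L (Suc n) ! (length (L n) + i)"
        unfolding s_def by (rule L_nth[symmetric]) (use that in \<open>simp add: L_Suc n\<close>)
      also have "\<dots> = w ! i" using that by (simp add: L_Suc n nth_append)
      finally show ?thesis .
    qed
    then show ?thesis by blast
  qed
  ultimately show ?thesis by blast
qed

context
  fixes e :: "nat \<Rightarrow> 'n::finite \<Rightarrow> nat" and N :: nat
  assumes numbering: "part_numbering e" and N_eq: "N = 4 ^ CARD('n)"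
begin

section \<open>Existence and uniqueness of the half-open index\<close>

lemma digit_less: "i \<in> {1..N} \<Longrightarrow> e i j < 4"
  using numbering N_eq by (auto simp: part_numbering_def bij_betw_def)

lemma symbol_for_digits:
  assumes "\<And>j. c j < 4"
  obtains i where "i \<in> {1..N}" "e i = c"
proof -
  have "c \<in> e ` {1..N}"
    using numbering assms by (simp add: part_numbering_def bij_betw_def N_eq)
  then show thesis using that by blast
qed

lemma subcube_refine:
  assumes "x \<in> subcube e w"
  shows "\<exists>i\<in>{1..N}. x \<in> subcube e (w @ [i])"
proof -
  let ?h = "1 / 4 ^ Suc (length w) :: real"
  have "\<exists>d<4. (corner e w $ j + real d * ?h < x $ j \<or>
      corner e w $ j + real d * ?h = 0 \<and> x $ j = 0) \<and> x $ j \<le> corner e w $ j + real d * ?h + ?h" for j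
    using assms by (intro quarter_exists corner_nonneg) (auto simp: subcube_def)
  then obtain c :: "'n \<Rightarrow> nat" where c: "\<And>j. c j < 4"
      "\<And>j. (corner e w $ j + real (c j) * ?h < x $ j \<or>
      corner e w $ j + real (c j) * ?h = 0 \<and> x $ j = 0) \<and> x $ j \<le> corner e w $ j + real (c j) * ?h + ?h"
    by metis
  obtain i where "i \<in> {1..N}" "e i = c" using symbol_for_digits[of c] c(1) by blast
  then show ?thesis unfolding subcube_append_iff using c(2) by blast
qed

lemma subcube_append_inject:
  assumes "x \<in> subcube e (w @ [i])" "x \<in> subcube e (w @ [i'])" "i \<in> {1..N}" "i' \<in> {1..N}"
  shows "i = i'"
proof -
  have "e i j = e i' j" for j
    using assms(1,2) unfolding subcube_append_iff
    by (intro quarter_unique[of "corner e w $ j" "1 / 4 ^ Suc (length w)" _ "x $ j"] corner_nonneg) auto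
  then have "e i = e i'" by blast
  then show ?thesis
    using numbering assms(3,4) N_eq by (auto simp: part_numbering_def bij_betw_def inj_on_def)
qed

text \<open>Start from the empty word, whose part is the whole cube, and repeatedly append a symbol
  given by \<open>subcube_refine\<close>. \<open>W\<close> collects the words and \<open>s\<close>
  their letters.\<close>

lemma index_exists:
  assumes "x \<in> unit_cube"
  shows "\<exists>s\<in>symbol_sequences N. \<forall>k. x \<in> subcube e (prefix_of s k)"
proof -
  obtain next_symbol where nxt: "\<And>w. x \<in> subcube e w \<Longrightarrow>
      next_symbol w \<in> {1..N} \<and> x \<in> subcube e (w @ [next_symbol w])"
    using subcube_refine by metis
  define W where "W = rec_nat [] (\<lambda>_ w. w @ [next_symbol w])"
  define s where "s k = next_symbol (W k)" for k
  have W: "W k = prefix_of s k" for k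
  proof (induction k)
    case (Suc k)
    then show ?case by (simp add: prefix_of_Suc s_def) (simp add: W_def)
  qed (simp add: W_def prefix_of_def)
  have x: "x \<in> subcube e (W k)" for k
  proof (induction k)
    case 0
    then show ?case using assms by (simp add: W_def subcube_Nil)
  next
    case (Suc k)
    then show ?case using nxt by (simp add: W_def)
  qed
  have "s \<in> symbol_sequences N"
    using x nxt by (simp add: s_def symbol_sequences_def)
  then show ?thesis using x W by auto
qed

text \<open>Strong induction on the position: equal earlier letters give the same enclosing part,
  whose own parts are disjoint.\<close>

lemma index_unique:
  assumes "s \<in> symbol_sequences N" "\<And>k. x \<in> subcube e (prefix_of s k)"
    and "t \<in> symbol_sequences N" "\<And>k. x \<in> subcube e (prefix_of t k)"
  shows "s = t"
proof
  fix k
  show "s k = t k"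
  proof (induction k rule: less_induct)
    case (less k)
    then have "prefix_of s k = prefix_of t k" by (simp add: prefix_of_def)
    moreover have "s k \<in> {1..N}" "t k \<in> {1..N}"
      using assms(1,3) by (simp_all add: symbol_sequences_def)
    ultimately show ?case
      using assms(2,4)[of "Suc k"] subcube_append_inject by (simp add: prefix_of_Suc)
  qed
qed

lemma index_of_eqI:
  assumes "s \<in> symbol_sequences N" "\<And>k. x \<in> subcube e (prefix_of s k)"
  shows "index_of e x = s"
  unfolding index_of_def N_eq[symmetric] by (rule the_equality) (use assms index_unique in blast)+

lemma index_of_props:
  assumes "x \<in> unit_cube"
  shows "index_of e x \<in> symbol_sequences N" "x \<in> subcube e (prefix_of (index_of e x) k)"
  using index_exists[OF assms] index_of_eqI by metis+

section \<open>Convergence of expansions and diameters of parts\<close>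

lemma corner_prefix_of_upper:
  assumes "s \<in> symbol_sequences N" "k \<le> m"
  shows "corner e (prefix_of s m) $ j + 1 / 4 ^ m \<le> corner e (prefix_of s k) $ j + 1 / 4 ^ k"
  using \<open>k \<le> m\<close>
proof (induction m rule: dec_induct)
  case (step m)
  \<comment> \<open>A digit is at most 3, so the chosen quarter ends no later than the fourth one,
    where the enclosing part ends.\<close>
  have "e (s m) j < 4" using assms(1) by (intro digit_less) (simp add: symbol_sequences_def)
  then have "(real (e (s m) j) + 1) / 4 ^ Suc m \<le> 4 / 4 ^ Suc m"
    by (intro divide_right_mono) auto
  then show ?case using step.IH by (simp add: prefix_of_Suc corner_append add_divide_distrib)
qed simp

lemma corner_prefix_of_mono:
  "k \<le> m \<Longrightarrow> corner e (prefix_of s k) $ j \<le> corner e (prefix_of s m) $ j"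
  unfolding corner_prefix_of by (rule sum_mono2) auto

lemma expansion_sums:
  assumes "s \<in> symbol_sequences N"
  shows "(\<lambda>m. real (e (s m) j) / 4 ^ Suc m) sums (expansion e s $ j)"
proof -
  have "(\<Sum>m<k. real (e (s m) j) / 4 ^ Suc m) \<le> 1" for k
  proof -
    \<comment> \<open>Partial sums are corners of parts; level 0 is the unit cube, with upper end
      1.\<close>
    have "corner e (prefix_of s k) $ j + 1 / 4 ^ k \<le> 1"
      using corner_prefix_of_upper[OF assms, of 0 k j] by (simp add: corner_prefix_of)
    moreover have "0 \<le> (1::real) / 4 ^ k" by simp
    ultimately show ?thesis unfolding corner_prefix_of[symmetric] by linarith
  qed
  then have "summable (\<lambda>m. real (e (s m) j) / 4 ^ Suc m)"
    by (intro bounded_imp_summable[where B = 1]) (auto simp: lessThan_Suc_atMost[symmetric] simp del: sum.lessThan_Suc)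
  then show ?thesis by (simp add: expansion_def summable_sums)
qed

lemma expansion_lower:
  assumes "s \<in> symbol_sequences N"
  shows "corner e (prefix_of s k) $ j \<le> expansion e s $ j"
  unfolding corner_prefix_of using expansion_sums[OF assms, of j]
  by (metis (no_types, lifting) divide_nonneg_nonneg of_nat_0_le_iff sum_le_suminf sums_iff
      finite_lessThan zero_le_numeral zero_le_power)

lemma expansion_upper:
  assumes "s \<in> symbol_sequences N"
  shows "expansion e s $ j \<le> corner e (prefix_of s k) $ j + 1 / 4 ^ k"
proof (rule LIMSEQ_le_const2)
  show "(\<lambda>m. corner e (prefix_of s m) $ j) \<longlonglongrightarrow> expansion e s $ j"
    using expansion_sums[OF assms, of j] by (simp add: sums_def corner_prefix_of)
  have "corner e (prefix_of s m) $ j \<le> corner e (prefix_of s k) $ j + 1 / 4 ^ k" if "k \<le> m" for m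
  proof -
    have "0 \<le> (1::real) / 4 ^ m" by simp
    then show ?thesis using corner_prefix_of_upper[OF assms that, of j] by linarith
  qed
  then show "\<exists>M. \<forall>m\<ge>M. corner e (prefix_of s m) $ j \<le> corner e (prefix_of s k) $ j + 1 / 4 ^ k"
    by blast
qed

lemma expansion_in_closure:
  assumes "s \<in> symbol_sequences N"
  shows "expansion e s \<in> closure (subcube e (prefix_of s k))"
  unfolding closure_subcube
  using expansion_lower[OF assms] expansion_upper[OF assms] by (simp add: mem_box_cart)

text \<open>Bounding the Euclidean norm by the sum of the coordinates gives the factor n instead of
  the sharp sqrt(n); it is enough that the bound tends to 0.\<close>

lemma dist_closure_subcube:
  fixes x y :: "real ^ 'n"
  assumes "x \<in> closure (subcube e w)" "y \<in> closure (subcube e w)"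
  shows "dist x y \<le> real CARD('n) / 4 ^ length w"
proof -
  have "\<bar>(x - y) $ j\<bar> \<le> 1 / 4 ^ length w" for j
  proof -
    have "corner e w $ j \<le> x $ j" "x $ j \<le> corner e w $ j + 1 / 4 ^ length w"
        "corner e w $ j \<le> y $ j" "y $ j \<le> corner e w $ j + 1 / 4 ^ length w"
      using assms by (auto simp: closure_subcube mem_box_cart)
    then show ?thesis by simp
  qed
  then have "(\<Sum>j\<in>UNIV. \<bar>(x - y) $ j\<bar>) \<le> (\<Sum>j\<in>(UNIV :: 'n set). 1 / 4 ^ length w)"
    by (intro sum_mono) auto
  then show ?thesis using norm_le_l1_cart[of "x - y"] by (simp add: dist_norm)
qed

text \<open>The level is chosen positive because sensitivity takes it as the number of
  iterations.\<close>

lemma subcube_diameter_small: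
  assumes "0 < \<epsilon>"
  obtains k where "0 < k" "real CARD('n) / 4 ^ k < \<epsilon>"
proof -
  have "(\<lambda>k. real CARD('n) * (1 / 4) ^ k) \<longlonglongrightarrow> real CARD('n) * 0"
    by (intro tendsto_mult_left LIMSEQ_power_zero) simp
  then have "\<forall>\<^sub>F k in sequentially. real CARD('n) / 4 ^ k < \<epsilon>"
    using assms by (simp add: power_divide order_tendstoD)
  then have "\<forall>\<^sub>F k in sequentially. 0 < k \<and> real CARD('n) / 4 ^ k < \<epsilon>"
    using eventually_gt_at_top[of 0] by eventually_elim simp
  then show thesis using that eventually_happens' trivial_limit_sequentially by blast
qed

section \<open>The generator acts on indices as the shift\<close>

lemma point_of_eqI:
  assumes "\<And>k. x \<in> closure (subcube e (prefix_of s k))"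
  shows "point_of e s = x"
  unfolding point_of_def
proof (rule the_equality)
  fix y
  assume y: "\<forall>k. y \<in> closure (subcube e (prefix_of s k))"
  show "y = x"
  proof (rule ccontr)
    assume "y \<noteq> x"
    \<comment> \<open>Both points share a closed part at every level, and its diameter eventually
      drops below their distance.\<close>
    then obtain k where "real CARD('n) / 4 ^ k < dist y x"
      using subcube_diameter_small by (metis zero_less_dist_iff)
    then show False using dist_closure_subcube[OF y[rule_format] assms, of k] by simp
  qed
qed (use assms in blast)

lemma point_of_eq_expansion: "s \<in> symbol_sequences N \<Longrightarrow> point_of e s = expansion e s"
  by (simp add: expansion_in_closure point_of_eqI)

lemma point_of_index_of: "x \<in> unit_cube \<Longrightarrow> point_of e (index_of e x) = x"
  using index_of_props(2) closure_subset by (blast intro: point_of_eqI)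

text \<open>In base 4, multiplication by 4 moves every digit one place, and the first digit becomes
  the integer that is subtracted.\<close>

lemma expansion_shift:
  assumes "s \<in> symbol_sequences N"
  shows "expansion e (shift s) = (\<chi> j. 4 * expansion e s $ j - real (e (s 0) j))"
proof (unfold vec_eq_iff, intro allI)
  fix j
  have "(\<lambda>m. real (e (s (Suc m)) j) / 4 ^ Suc (Suc m)) sums
      (expansion e s $ j - real (e (s 0) j) / 4)"
    using sums_split_initial_segment[OF expansion_sums[OF assms, of j], of 1] by simp
  from sums_mult[OF this, of 4]
  have "(\<lambda>m. real (e (shift s m) j) / 4 ^ Suc m) sums (4 * expansion e s $ j - real (e (s 0) j))"
    by (simp add: shift_def algebra_simps)
  then show "expansion e (shift s) $ j = (\<chi> j. 4 * expansion e s $ j - real (e (s 0) j)) $ j"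
    using expansion_sums[OF shift_in_symbol_sequences[OF assms], of j] sums_unique2 by auto
qed

text \<open>On each first-level part the generator is the enlarging affine map, so
  \<open>subcube_ConsD\<close> applies at every point of the cube. Iterates can therefore be
  followed through the index alone.\<close>

lemma generator_props:
  assumes "x \<in> unit_cube"
  shows "generator e x \<in> unit_cube" "index_of e (generator e x) = shift (index_of e x)"
proof -
  define s where "s = index_of e x"
  have s: "s \<in> symbol_sequences N" and x: "\<And>k. x \<in> subcube e (prefix_of s k)"
    using index_of_props[OF assms] by (simp_all add: s_def)
  have "expansion e s = x"
    using point_of_index_of[OF assms] point_of_eq_expansion[OF s] by (simp add: s_def)
  then have gen: "generator e x = (\<chi> j. 4 * x $ j - real (e (s 0) j))"
    using expansion_shift[OF s] point_of_eq_expansion[OF shift_in_symbol_sequences[OF s]]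
    by (simp add: generator_def s_def)
  have sub: "generator e x \<in> subcube e (prefix_of (shift s) k)" for k
    unfolding gen using x[of "Suc k"] by (intro subcube_ConsD) (simp add: prefix_of_Suc_shift)
  from sub[of 0] show "generator e x \<in> unit_cube" by (simp add: prefix_of_def subcube_Nil)
  show "index_of e (generator e x) = shift (index_of e x)"
    using sub shift_in_symbol_sequences[OF s] by (simp add: index_of_eqI s_def)
qed

lemma funpow_generator:
  assumes "x \<in> unit_cube"
  shows "(generator e ^^ p) x \<in> unit_cube"
    and "index_of e ((generator e ^^ p) x) = (shift ^^ p) (index_of e x)"
proof (induction p)
  case (Suc p)
  case 1 show ?case using Suc generator_props by simp
  case 2 show ?case using Suc generator_props by simp
qed (use assms in simp_all)

text \<open>A nonzero digit at or after position \<open>k\<close> lifts the point strictly off the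
  lower face of its part of level \<open>k\<close>; the upper face belongs to the part
  anyway.\<close>

lemma rich_expansion:
  assumes s: "s \<in> symbol_sequences N" and "rich e s"
  shows "expansion e s \<in> unit_cube" "index_of e (expansion e s) = s"
proof -
  have sub: "expansion e s \<in> subcube e (prefix_of s k)" for k
  proof -
    have "corner e (prefix_of s k) $ j < expansion e s $ j" for j
    proof -
      obtain m where m: "k \<le> m" "0 < e (s m) j" using assms(2) by (auto simp: rich_def)
      have "corner e (prefix_of s k) $ j \<le> corner e (prefix_of s m) $ j"
        using m(1) by (rule corner_prefix_of_mono)
      also have "\<dots> < corner e (prefix_of s (Suc m)) $ j"
        using m(2) by (simp add: prefix_of_Suc corner_append)
      also have "\<dots> \<le> expansion e s $ j" by (rule expansion_lower[OF s])
      finally show ?thesis .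
    qed
    then show ?thesis using expansion_upper[OF s] by (simp add: subcube_def)
  qed
  from sub[of 0] show "expansion e s \<in> unit_cube" by (simp add: prefix_of_def subcube_Nil)
  show "index_of e (expansion e s) = s" using s sub by (rule index_of_eqI)
qed

section \<open>Witness sequences\<close>

lemma expansion_const:
  assumes "a \<in> {1..N}" "\<And>j. e a j = d"
  shows "expansion e (\<lambda>_. a) $ j = real d / 3"
proof -
  \<comment> \<open>Geometric series of ratio 1/4. Digits 3 and 1 give the coordinates 1 and 1/3,
    hence the gap 2/3 used for sensitivity.\<close>
  have "(\<lambda>m. real d / 4 * (1 / 4) ^ m) sums (real d / 4 * (1 / (1 - 1 / 4)))"
    by (intro sums_mult geometric_sums) simp
  then have "(\<lambda>m. real (e a j) / 4 ^ Suc m) sums (real d / 3)"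
    by (simp add: assms(2) power_divide)
  moreover have "(\<lambda>_. a) \<in> symbol_sequences N" using assms(1) by (simp add: symbol_sequences_def)
  ultimately show ?thesis using expansion_sums sums_unique2 by blast
qed

lemma dist_expansion_prefix:
  assumes "s \<in> symbol_sequences N" "t \<in> symbol_sequences N" "prefix_of s k = prefix_of t k"
  shows "dist (expansion e s) (expansion e t) \<le> real CARD('n) / 4 ^ k"
  using dist_closure_subcube[of "expansion e s" "prefix_of s k" "expansion e t"]
    expansion_in_closure[OF assms(1), of k] expansion_in_closure[OF assms(2), of k] assms(3)
  by simp

lemma rich_periodic_approximation:
  assumes s: "s \<in> symbol_sequences N" and "0 < \<epsilon>"
  shows "\<exists>t\<in>symbol_sequences N. rich e t \<and> (\<exists>p>0. \<forall>m. t (m + p) = t m) \<and>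
    dist (expansion e t) (expansion e s) < \<epsilon>"
proof -
  obtain a where a: "a \<in> {1..N}" "e a = (\<lambda>_. 3)" by (rule symbol_for_digits) auto
  obtain k where k: "real CARD('n) / 4 ^ k < \<epsilon>" using subcube_diameter_small[OF \<open>0 < \<epsilon>\<close>] by metis
  \<comment> \<open>The block is the first \<open>k\<close> letters of \<open>s\<close>, which gives
    closeness, followed by \<open>a\<close>, which gives richness; the period is
    \<open>Suc k\<close>.\<close>
  define t where "t m = (if m mod Suc k < k then s (m mod Suc k) else a)" for m
  have t: "t \<in> symbol_sequences N" using s a(1) by (simp add: symbol_sequences_def t_def)
  have "e (t (q * Suc k + k)) j = 3" for q j
    by (simp only: t_def mod_mult_self3 mod_less lessI) (simp add: a(2))
  moreover have "q \<le> q * Suc k + k" for q by simp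
  ultimately have "rich e t" unfolding rich_def by (metis zero_less_numeral)
  moreover have "t (m + Suc k) = t m" for m by (simp only: t_def mod_add_self2)
  moreover have "prefix_of t k = prefix_of s k" by (simp add: prefix_of_def t_def)
  ultimately show ?thesis
    using t k dist_expansion_prefix[OF t s, of k] by (meson zero_less_Suc le_less_trans)
qed

lemma rich_sensitive_approximation:
  assumes s: "s \<in> symbol_sequences N" and "0 < \<epsilon>"
  shows "\<exists>t\<in>symbol_sequences N. rich e t \<and> dist (expansion e s) (expansion e t) < \<epsilon> \<and>
    (\<exists>p>0. 1 / 3 \<le> dist (expansion e ((shift ^^ p) s)) (expansion e ((shift ^^ p) t)))"
proof -
  obtain a where a: "a \<in> {1..N}" "e a = (\<lambda>_. 3)" by (rule symbol_for_digits) auto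
  \<comment> \<open>Digit 1 instead of 0: a tail of this symbol must still be rich.\<close>
  obtain b where b: "b \<in> {1..N}" "e b = (\<lambda>_. 1)" by (rule symbol_for_digits) auto
  obtain k where k: "0 < k" "real CARD('n) / 4 ^ k < \<epsilon>"
    using subcube_diameter_small[OF \<open>0 < \<epsilon>\<close>] by metis
  let ?x = "expansion e ((shift ^^ k) s)"
  have "2 / 3 \<le> dist (expansion e (\<lambda>_. a)) (expansion e (\<lambda>_. b))"
  proof -
    fix j :: 'n
    have "dist (expansion e (\<lambda>_. a) $ j) (expansion e (\<lambda>_. b) $ j) = 2 / 3"
      by (simp add: expansion_const[OF a(1), of 3] expansion_const[OF b(1), of 1] a(2) b(2) dist_real_def)
    \<comment> \<open>The distance in a single coordinate bounds the Euclidean distance from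
      below.\<close>
    then show ?thesis by (metis dist_vec_nth_le)
  qed
  also have "\<dots> \<le> dist ?x (expansion e (\<lambda>_. a)) + dist ?x (expansion e (\<lambda>_. b))"
    by (metis dist_commute dist_triangle)
  finally have "\<exists>c\<in>{a, b}. 1 / 3 \<le> dist ?x (expansion e (\<lambda>_. c))" by auto
  then obtain c where c: "c \<in> {1..N}" "\<And>j. 0 < e c j" "1 / 3 \<le> dist ?x (expansion e (\<lambda>_. c))"
    using a b by auto
  \<comment> \<open>Agreement with \<open>s\<close> up to \<open>k\<close> keeps the points close;
    after \<open>k\<close> shifts exactly the constant tail far from \<open>?x\<close>
    remains.\<close>
  define t where "t m = (if m < k then s m else c)" for m
  have t: "t \<in> symbol_sequences N" using s c(1) by (simp add: symbol_sequences_def t_def)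
  have "rich e t" unfolding rich_def
  proof (intro allI)
    fix j l
    show "\<exists>m\<ge>l. 0 < e (t m) j" using c(2) by (intro exI[of _ "l + k"]) (simp add: t_def)
  qed
  moreover have "(shift ^^ k) t = (\<lambda>_. c)" by (simp add: funpow_shift t_def)
  then have "1 / 3 \<le> dist ?x (expansion e ((shift ^^ k) t))" using c(3) by simp
  moreover have "prefix_of s k = prefix_of t k" by (simp add: prefix_of_def t_def)
  then have "dist (expansion e s) (expansion e t) < \<epsilon>"
    using dist_expansion_prefix[OF s t] k(2) by fastforce
  ultimately show ?thesis using t k(1) by blast
qed

lemma rich_universal_sequence:
  "\<exists>l\<in>symbol_sequences N. rich e l \<and>
    (\<forall>w\<in>lists {1..N}. \<exists>p>0. prefix_of ((shift ^^ p) l) (length w) = w)"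
proof -
  obtain a where a: "a \<in> {1..N}" "e a = (\<lambda>_. 3)" by (rule symbol_for_digits) auto
  obtain l where l: "l \<in> symbol_sequences N"
      "\<And>w. w \<in> lists {1..N} \<Longrightarrow> \<exists>p. \<forall>i<length w. l (p + i) = w ! i"
    using universal_sequence[of N] N_eq by auto
  have "\<exists>m\<ge>k. 0 < e (l m) j" for j k
  proof -
    \<comment> \<open>A run of \<open>k + 1\<close> copies of \<open>a\<close> occurs somewhere; its
      last letter sits at a position at least \<open>k\<close> and has nonzero digits.\<close>
    have "replicate (Suc k) a \<in> lists {1..N}" using a(1) by auto
    from l(2)[OF this] obtain p where "\<forall>i<Suc k. l (p + i) = replicate (Suc k) a ! i"
      by (auto simp del: replicate_Suc)
    then have "l (p + k) = a" by (metis lessI nth_replicate)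
    then show ?thesis using a(2) by (intro exI[of _ "p + k"]) simp
  qed
  then have "rich e l" by (simp add: rich_def)
  moreover have "\<exists>p>0. prefix_of ((shift ^^ p) l) (length w) = w" if w: "w \<in> lists {1..N}" for w
  proof -
    \<comment> \<open>Prepending a letter makes the occurrence of \<open>w\<close> start at
      \<open>Suc p\<close>, so the number of iterations is positive.\<close>
    have "a # w \<in> lists {1..N}" using a(1) w by auto
    from l(2)[OF this] obtain p where p: "\<forall>i<Suc (length w). l (p + i) = (a # w) ! i" by auto
    have "l (i + Suc p) = w ! i" if "i < length w" for i
      using p[rule_format, of "Suc i"] that by (simp add: add.commute)
    then have "prefix_of ((shift ^^ Suc p) l) (length w) = w"
      by (intro nth_equalityI) (auto simp: prefix_of_def funpow_shift simp del: funpow.simps)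
    then show ?thesis by blast
  qed
  ultimately show ?thesis using l(1) by blast
qed

lemma funpow_shift_in_symbol_sequences:
  "s \<in> symbol_sequences N \<Longrightarrow> (shift ^^ p) s \<in> symbol_sequences N"
  by (simp add: funpow_shift symbol_sequences_def)

section \<open>Chaos on the points of the cube and on the infinite indices\<close>

lemma unit_cube_devaney_chaotic:
  "devaney_chaotic N unit_cube (\<lambda>x. x) (index_of e) (subcube e) (generator e)"
  unfolding devaney_chaotic_def
proof (intro conjI)
  have expansion_index: "expansion e (index_of e x) = x" if "x \<in> unit_cube" for x
    using point_of_index_of[OF that] point_of_eq_expansion[OF index_of_props(1)[OF that]] by simp
  \<comment> \<open>Orbits in the cube become expansions of shifted indices, which carries the
    witnesses over from sequences.\<close>
  have expansion_orbit: "(generator e ^^ p) x = expansion e ((shift ^^ p) (index_of e x))"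
    if "x \<in> unit_cube" for x p
    using expansion_index[OF funpow_generator(1)[OF that]] funpow_generator(2)[OF that] by metis
  show "periodic_points_dense unit_cube (\<lambda>x. x) (index_of e)"
    unfolding periodic_points_dense_def image_ident
  proof (intro subsetI closure_approachable[THEN iffD2] allI impI)
    fix x :: "real ^ 'n" and \<epsilon> :: real
    assume x: "x \<in> unit_cube" and "0 < \<epsilon>"
    obtain t p where "t \<in> symbol_sequences N" "rich e t" "0 < p" "\<forall>m. t (m + p) = t m"
        "dist (expansion e t) (expansion e (index_of e x)) < \<epsilon>"
      using rich_periodic_approximation[OF index_of_props(1)[OF x] \<open>0 < \<epsilon>\<close>] by blast
    then show "\<exists>y\<in>{x \<in> unit_cube. \<exists>p. periodic_point (index_of e) p x}. dist y x < \<epsilon>"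
      using rich_expansion[of t] expansion_index[OF x]
      by (intro bexI[of _ "expansion e t"]) (auto simp: periodic_point_def)
  qed
  show "transitive_map N unit_cube (subcube e) (generator e)"
  proof -
    obtain l where l: "l \<in> symbol_sequences N" "rich e l"
      "\<And>w. w \<in> lists {1..N} \<Longrightarrow> \<exists>p>0. prefix_of ((shift ^^ p) l) (length w) = w"
      using rich_universal_sequence by blast
    note x = rich_expansion[OF l(1,2)]
    \<comment> \<open>Each iterate lies in the half-open parts of its own index, and that index
      begins with \<open>w\<close> for a suitable \<open>p\<close>.\<close>
    have "\<exists>p>0. (generator e ^^ p) (expansion e l) \<in> subcube e w" if "w \<in> lists {1..N}" for w
      using l(3)[OF that] index_of_props(2)[OF funpow_generator(1)[OF x(1)]]
        funpow_generator(2)[OF x(1)] x(2) by metis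
    then show ?thesis unfolding transitive_map_def using x(1) by blast
  qed
  show "sensitive_map unit_cube (\<lambda>x. x) (generator e)"
    unfolding sensitive_map_def
  proof (intro exI[of _ "1 / 3"] conjI ballI allI impI)
    fix x :: "real ^ 'n" and \<epsilon> :: real
    assume x: "x \<in> unit_cube" and "0 < \<epsilon>"
    obtain t p where t: "t \<in> symbol_sequences N" "rich e t" "0 < p"
        "dist (expansion e (index_of e x)) (expansion e t) < \<epsilon>"
        "1 / 3 \<le> dist (expansion e ((shift ^^ p) (index_of e x))) (expansion e ((shift ^^ p) t))"
      using rich_sensitive_approximation[OF index_of_props(1)[OF x] \<open>0 < \<epsilon>\<close>] by blast
    note y = rich_expansion[OF t(1,2)]
    show "\<exists>y\<in>unit_cube. dist x y < \<epsilon> \<and>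
        (\<exists>p>0. 1 / 3 \<le> dist ((generator e ^^ p) x) ((generator e ^^ p) y))"
      using t(3-5) y expansion_index[OF x] expansion_orbit[OF x, of p] expansion_orbit[OF y(1), of p]
      by metis
  qed simp
qed

text \<open>Here a point is its own index, so the witness sequences serve directly; only distances
  pass through \<open>point_of\<close>, rewritten as \<open>expansion\<close>.\<close>

lemma symbol_sequences_devaney_chaotic:
  "devaney_chaotic N (symbol_sequences N) (point_of e) (\<lambda>s. s) (cylinder N) shift"
  unfolding devaney_chaotic_def
proof (intro conjI)
  show "periodic_points_dense (symbol_sequences N) (point_of e) (\<lambda>s. s)"
    unfolding periodic_points_dense_def
  proof (intro image_subsetI closure_approachable[THEN iffD2] allI impI)
    fix s and \<epsilon> :: real
    assume s: "s \<in> symbol_sequences N" and "0 < \<epsilon>"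
    then show "\<exists>y\<in>point_of e ` {x \<in> symbol_sequences N. \<exists>p. periodic_point (\<lambda>s. s) p x}.
        dist y (point_of e s) < \<epsilon>"
      using rich_periodic_approximation[OF s \<open>0 < \<epsilon>\<close>]
      by (auto simp: periodic_point_def point_of_eq_expansion)
  qed
  show "transitive_map N (symbol_sequences N) (cylinder N) shift"
    unfolding transitive_map_def cylinder_def mem_Collect_eq
    using rich_universal_sequence by (meson funpow_shift_in_symbol_sequences)
  show "sensitive_map (symbol_sequences N) (point_of e) shift"
    unfolding sensitive_map_def
  proof (intro exI[of _ "1 / 3"] conjI ballI allI impI)
    fix s and \<epsilon> :: real
    assume s: "s \<in> symbol_sequences N" and "0 < \<epsilon>"
    obtain t p where t: "t \<in> symbol_sequences N" "0 < p"
        "dist (expansion e s) (expansion e t) < \<epsilon>"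
        "1 / 3 \<le> dist (expansion e ((shift ^^ p) s)) (expansion e ((shift ^^ p) t))"
      using rich_sensitive_approximation[OF s \<open>0 < \<epsilon>\<close>] by blast
    show "\<exists>y\<in>symbol_sequences N. dist (point_of e s) (point_of e y) < \<epsilon> \<and>
        (\<exists>p>0. 1 / 3 \<le> dist (point_of e ((shift ^^ p) s)) (point_of e ((shift ^^ p) y)))"
      using s t
      by (intro bexI[of _ t] conjI exI[of _ p])
        (simp_all add: point_of_eq_expansion funpow_shift_in_symbol_sequences)
  qed simp
qed

end

theorem mainTheorem2:
  fixes e :: "nat \<Rightarrow> 'n::finite \<Rightarrow> nat"
  assumes "part_numbering e"
  shows "devaney_chaotic (4 ^ CARD('n)) (unit_cube :: (real ^ 'n) set)
           (\<lambda>x. x) (index_of e) (subcube e) (generator e) \<and>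
         devaney_chaotic (4 ^ CARD('n)) (symbol_sequences (4 ^ CARD('n)))
           (point_of e) (\<lambda>s. s) (cylinder (4 ^ CARD('n))) shift"
  using unit_cube_devaney_chaotic[OF assms refl] symbol_sequences_devaney_chaotic[OF assms refl] by blast

end
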